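(* For all boxes $(a,b)\in \lambda$, the function $p_{a,b}(\theta_\cdot)$ is a Laurent polynomial in the variables $\theta_{i,j}$, $(i,j)\in\lambda^*$, with non-negative integer coefficients.
   Context: Let $\lambda=(\lambda_1,\dots,\lambda_N)$ be a partition with $\lambda_1\geq\lambda_2\geq\cdots\geq\lambda_N\geq 1$, drawn as a Young diagram with rows $1,\dots,N$ from top to bottom, left-justified; the box $(i,j)$ is in row $i$ and column $j\in[1,\lambda_i]$. The extended Young diagram $\lambda^*$ is obtained by adjoining a border strip from the end of the first row to the end of the first column of $\lambda$, i.e. $\lambda^*_1=\lambda_1+1$ and $\lambda^*_i=\lambda_{i-1}+1$ for $i=2,\dots,N+1$ (e.g. for $\lambda=(3,2)$, $\lambda^*=(4,4,3)$). For each box $(a,b)\in\lambda^*$, let $S_{a,b}=\{(i,j): a\leq i\leq a+n_{a,b}-1,\ b\leq j\leq b+n_{a,b}-1\}$ be the largest square array of boxes with North-West corner $(a,b)$ contained in $\lambda^*$; its size $n_{a,b}\geq 1$ is maximal with $S_{a,b}\subset\lambda^*$. (Each box of $\lambda^*\setminus\lambda$ is a square of size $1$.) Fix arbitrary non-zero parameters $\theta_{i,j}$, one for each box $(i,j)\in\lambda^*$. Functions $p_{i,j}(\theta_\cdot)$, one for each box $(i,j)\in\lambda^*$, are defined by the system of identities $$\det\Big(\big(p_{a+i-1,b+j-1}(\theta_\cdot)\big)_{1\leq i,j\leq n_{a,b}}\Big)=\theta_{a,b}\qquad\text{for all }(a,b)\in\lambda^*,$$ i.e. the determinant of the array of the $p$'s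 over each square $S_{a,b}$ equals $\theta_{a,b}$. In particular $p_{u,v}=\theta_{u,v}$ for $(u,v)\in\lambda^*\setminus\lambda$. This system has a unique solution. *)

theory Defs
  imports "Jordan_Normal_Form.Determinant" "HOL-Library.Poly_Mapping"
begin

text \<open>Partitions are lists of row lengths; boxes are indexed from 1 in both coordinates.\<close>

definition is_partition :: "nat list \<Rightarrow> bool" where
  "is_partition lam \<longleftrightarrow> lam \<noteq> [] \<and> sorted_wrt (\<ge>) lam \<and> (\<forall>r\<in>set lam. 1 \<le> r)"

definition diagram :: "nat list \<Rightarrow> (nat \<times> nat) set" where
  "diagram lam = {(i, j). 1 \<le> i \<and> i \<le> length lam \<and> 1 \<le> j \<and> j \<le> lam ! (i - 1)}"

definition extended :: "nat list \<Rightarrow> nat list" where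
  "extended lam = (hd lam + 1) # map (\<lambda>r. r + 1) lam"

definition square :: "nat \<times> nat \<Rightarrow> nat \<Rightarrow> (nat \<times> nat) set" where
  "square = (\<lambda>(a, b) n. {(i, j). a \<le> i \<and> i < a + n \<and> b \<le> j \<and> j < b + n})"

definition square_size :: "nat list \<Rightarrow> nat \<times> nat \<Rightarrow> nat" where
  "square_size lam c = (GREATEST n. square c n \<subseteq> diagram (extended lam))"

text \<open>Matrices are indexed from 0, hence \<open>p (a + i, b + j)\<close> without the shift by 1.\<close>

definition solves_system ::
  "nat list \<Rightarrow> (nat \<times> nat \<Rightarrow> 'a :: field) \<Rightarrow> (nat \<times> nat \<Rightarrow> 'a) \<Rightarrow> bool" where
  "solves_system lam \<theta> p \<longleftrightarrow>
     (\<forall>(a, b) \<in> diagram (extended lam).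
        det (mat (square_size lam (a, b)) (square_size lam (a, b))
               (\<lambda>(i, j). p (a + i, b + j))) = \<theta> (a, b))"

text \<open>The system has a solution, and it is unique on the extended diagram; both follow from
  expanding each determinant along its corner entry, whose cofactor is the next one on the
  diagonal.\<close>

lemma diagram_extended_down_closed:
  assumes "is_partition lam" "(i, j) \<in> diagram (extended lam)"
    and "1 \<le> i'" "i' \<le> i" "1 \<le> j'" "j' \<le> j"
  shows "(i', j') \<in> diagram (extended lam)"
proof -
  have s: "sorted_wrt (\<ge>) (extended lam)"
  proof (cases lam)
    case (Cons x xs)
    then show ?thesis using assms(1)
      by (auto simp: is_partition_def extended_def sorted_wrt_map)
  qed (use assms(1) in \<open>simp add: is_partition_def\<close>)
  have "extended lam ! (i - 1) \<le> extended lam ! (i' - 1)"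
  proof (cases "i' = i")
    case False
    with assms have "i' - 1 < i - 1" "i - 1 < length (extended lam)" 
      by (auto simp: diagram_def)
    from sorted_wrt_nth_less[OF s this] show ?thesis by simp
  qed simp
  with assms show ?thesis by (auto simp: diagram_def)
qed

lemma square_subset_iff:
  assumes "is_partition lam" "1 \<le> a" "1 \<le> b"
  shows "square (a, b) n \<subseteq> diagram (extended lam) \<longleftrightarrow>
           n = 0 \<or> (a + n - 1, b + n - 1) \<in> diagram (extended lam)"
proof (cases "n = 0")
  case False
  show ?thesis
  proof
    assume "square (a, b) n \<subseteq> diagram (extended lam)"
    moreover have "(a + n - 1, b + n - 1) \<in> square (a, b) n"
      using False by (auto simp: square_def)
    ultimately show "n = 0 \<or> (a + n - 1, b + n - 1) \<in> diagram (extended lam)" by blast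
  next
    assume "n = 0 \<or> (a + n - 1, b + n - 1) \<in> diagram (extended lam)"
    with False have "(a + n - 1, b + n - 1) \<in> diagram (extended lam)" by simp
    then show "square (a, b) n \<subseteq> diagram (extended lam)"
      using assms
      by (auto simp: square_def intro: diagram_extended_down_closed[OF assms(1)
          \<open>(a + n - 1, b + n - 1) \<in> diagram (extended lam)\<close>])
  qed
qed (auto simp: square_def)

lemma square_size_props:
  assumes "is_partition lam" "(a, b) \<in> diagram (extended lam)"
  shows "square_size lam (a, b) \<ge> 1"
    and "square (a, b) (square_size lam (a, b)) \<subseteq> diagram (extended lam)"
    and "\<And>n. square (a, b) n \<subseteq> diagram (extended lam) \<Longrightarrow> n \<le> square_size lam (a, b)"
proof -
  let ?P = "\<lambda>n. square (a, b) n \<subseteq> diagram (extended lam)"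
  have ab: "1 \<le> a" "1 \<le> b" using assms(2) by (auto simp: diagram_def)
  note iff = square_subset_iff[OF assms(1) ab]
  have bound: "n \<le> length (extended lam)" if "?P n" for n
    using that ab unfolding iff by (auto simp: diagram_def)
  have P1: "?P 1" using assms(2) unfolding iff by simp
  show "?P (square_size lam (a, b))"
    unfolding square_size_def using GreatestI_nat[of ?P, OF P1] bound by blast
  show le: "n \<le> square_size lam (a, b)" if "?P n" for n
    unfolding square_size_def using Greatest_le_nat[of ?P, OF that] bound by blast
  show "square_size lam (a, b) \<ge> 1" using le[OF P1] .
qed

lemma square_size_diagonal:
  assumes "is_partition lam" "(a, b) \<in> diagram (extended lam)" "square_size lam (a, b) > 1"
  shows "(Suc a, Suc b) \<in> diagram (extended lam)"
    and "square_size lam (Suc a, Suc b) = square_size lam (a, b) - 1"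
proof -
  let ?n = "square_size lam (a, b)" and ?m = "square_size lam (Suc a, Suc b)"
  have ab: "1 \<le> a" "1 \<le> b" using assms(2) by (auto simp: diagram_def)
  note sp = square_size_props[OF assms(1,2)]
  have "(Suc a, Suc b) \<in> square (a, b) ?n" using assms(3) by (auto simp: square_def)
  with sp(2) show d: "(Suc a, Suc b) \<in> diagram (extended lam)" by blast
  note sq = square_size_props[OF assms(1) d]
  have "square (Suc a, Suc b) (?n - 1) \<subseteq> diagram (extended lam)"
    using sp(2) assms(3) ab by (auto simp: square_subset_iff[OF assms(1)])
  from sq(3)[OF this] have 1: "?n - 1 \<le> ?m" .
  have "square (a, b) (Suc ?m) \<subseteq> diagram (extended lam)"
    using sq(1,2) ab by (auto simp: square_subset_iff[OF assms(1)])
  from sp(3)[OF this] 1 show "?m = ?n - 1" by simp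
qed

definition block_det :: "nat list \<Rightarrow> (nat \<times> nat \<Rightarrow> 'a :: field) \<Rightarrow> nat \<times> nat \<Rightarrow> 'a" where
  "block_det lam p = (\<lambda>(a, b). det (mat (square_size lam (a, b)) (square_size lam (a, b))
               (\<lambda>(i, j). p (a + i, b + j))))"

lemma solves_system_block_det:
  "solves_system lam \<theta> p \<longleftrightarrow> (\<forall>c \<in> diagram (extended lam). block_det lam p c = \<theta> c)"
  by (auto simp: solves_system_def block_det_def)

lemma block_det_cong:
  assumes "\<And>c. c \<in> square (a, b) (square_size lam (a, b)) \<Longrightarrow> p c = q c"
  shows "block_det lam p (a, b) = block_det lam q (a, b)"
  unfolding block_det_def using assms
  by (auto intro!: arg_cong[of _ _ det] eq_matI simp: square_def)

lemma block_det_corner: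
  fixes p :: "nat \<times> nat \<Rightarrow> 'a :: field"
  assumes "is_partition lam" "(a, b) \<in> diagram (extended lam)"
  shows "block_det lam p (a, b) =
           p (a, b) * (if square_size lam (a, b) = 1 then 1 else block_det lam p (Suc a, Suc b))
           + block_det lam (p((a, b) := 0)) (a, b)"
proof -
  let ?n = "square_size lam (a, b)"
  define A where "A = (\<lambda>q. mat ?n ?n (\<lambda>(i, j). (q :: nat \<times> nat \<Rightarrow> 'a) (a + i, b + j)))"
  let ?q = "p((a, b) := 0)"
  have n: "0 < ?n" using square_size_props(1)[OF assms] by simp
  have exp: "det (A q) = (\<Sum>j<?n. q (a, b + j) * cofactor (A q) 0 j)" for q
    using laplace_expansion_row[of "A q" ?n 0] n by (auto simp: A_def intro!: sum.cong)
  have cof: "cofactor (A ?q) 0 j = cofactor (A p) 0 j" if "j < ?n" for j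
    using that by (auto simp: cofactor_def mat_delete_def A_def
       intro!: arg_cong[of _ _ det] eq_matI)
  have c0: "cofactor (A p) 0 0 = 
      (if ?n = 1 then 1 else block_det lam p (Suc a, Suc b))"
  proof (cases "?n = 1")
    case True
    then show ?thesis by (simp add: cofactor_def mat_delete_def A_def)
  next
    case False
    with n have "?n > 1" by simp
    from square_size_diagonal(2)[OF assms this] False show ?thesis
      by (auto simp: cofactor_def mat_delete_def A_def block_det_def
        intro!: arg_cong[of _ _ det] eq_matI)
  qed
  have split: "{..<?n} = insert 0 {1..<?n}" using n by auto
  have e: "det (A p) = p (a, b) * cofactor (A p) 0 0 + det (A ?q)"
    unfolding exp split by (simp add: cof)
  show ?thesis using e unfolding c0 by (simp add: A_def block_det_def)
qed

lemma solves_system_exists: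
  fixes \<theta> :: "nat \<times> nat \<Rightarrow> 'a :: field"
  assumes lam: "is_partition lam" and nz: "\<forall>c \<in> diagram (extended lam). \<theta> c \<noteq> 0"
  shows "\<exists>p. solves_system lam \<theta> p"
proof -
  define D where "D = diagram (extended lam)"
  have "D \<subseteq> Sigma {..length (extended lam)} (\<lambda>i. {..extended lam ! (i - 1)})"
    by (auto simp: D_def diagram_def)
  then have "finite D" by (rule finite_subset) auto
  then have "finite ((\<lambda>(a, b). a + b) ` D)" by blast
  then obtain M where M: "a + b < M" if "(a, b) \<in> D" for a b
    unfolding finite_nat_set_iff_bounded by fastforce
  have "\<exists>p. \<forall>(a, b) \<in> D. M \<le> a + b + k \<longrightarrow> block_det lam p (a, b) = \<theta> (a, b)" for k
  proof (induction k)
    case 0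
    have "\<not> M \<le> a + b + 0" if "(a, b) \<in> D" for a b using M[OF that] by simp
    then show ?case by blast
  next
    case (Suc k)
    then obtain p where p: "\<And>a b. (a, b) \<in> D \<Longrightarrow> M \<le> a + b + k \<Longrightarrow> block_det lam p (a, b) = \<theta> (a, b)"
      by blast
    define p' where "p' = (\<lambda>(a, b). if M \<le> a + b + k then p (a, b) else
      (\<theta> (a, b) - block_det lam (p((a, b) := 0)) (a, b)) /
      (if square_size lam (a, b) = 1 then 1 else block_det lam p (Suc a, Suc b)))"
    have "block_det lam p' (a, b) = \<theta> (a, b)" if ab: "(a, b) \<in> D" "M \<le> a + b + Suc k" for a b
    proof (cases "M \<le> a + b + k")
      case True
      have "block_det lam p' (a, b) = block_det lam p (a, b)"
        by (rule block_det_cong) (use True in \<open>auto simp: square_def p'_def\<close>)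
      with p[OF ab(1) True] show ?thesis by simp
    next
      case False
      let ?u = "if square_size lam (a, b) = 1 then 1 else block_det lam p (Suc a, Suc b)"
      have 1: "block_det lam (p'((a, b) := 0)) (a, b) = block_det lam (p((a, b) := 0)) (a, b)"
      proof (rule block_det_cong)
        fix d assume "d \<in> square (a, b) (square_size lam (a, b))"
        then obtain i j where d: "d = (i, j)" "a \<le> i" "b \<le> j" by (auto simp: square_def)
        show "(p'((a, b) := 0)) d = (p((a, b) := 0)) d"
        proof (cases "d = (a, b)")
          case False
          with d have "a + b < i + j" by auto
          with ab(2) have "M \<le> i + j + k" by simp
          then have "p' d = p d" by (simp add: d(1) p'_def)
          with False show ?thesis by simp
        qed simp
      qed
      have 2: "block_det lam p' (Suc a, Suc b) = block_det lam p (Suc a, Suc b)"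
        by (rule block_det_cong) (use False ab(2) in \<open>auto simp: square_def p'_def\<close>)
      have 3: "?u \<noteq> 0"
      proof (cases "square_size lam (a, b) = 1")
        case False
        with square_size_props(1)[OF lam ab(1)[unfolded D_def]] 
        have "square_size lam (a, b) > 1" by simp
        from square_size_diagonal(1)[OF lam ab(1)[unfolded D_def] this]
        have "(Suc a, Suc b) \<in> D" by (simp add: D_def)
        moreover have "M \<le> Suc a + Suc b + k" using ab(2) by simp
        ultimately have "block_det lam p (Suc a, Suc b) = \<theta> (Suc a, Suc b)" by (rule p)
        moreover have "\<theta> (Suc a, Suc b) \<noteq> 0" using nz \<open>(Suc a, Suc b) \<in> D\<close> unfolding D_def by blast
        ultimately show ?thesis using False by simp
      qed simp
      have 4: "p' (a, b) = (\<theta> (a, b) - block_det lam (p((a, b) := 0)) (a, b)) / ?u"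
        using False by (simp add: p'_def)
      show ?thesis
        using block_det_corner[OF lam ab(1)[unfolded D_def], of p']
        unfolding 1 2 4 nonzero_divide_eq_eq[OF 3] times_divide_eq_left
        by (simp only: nonzero_mult_div_cancel_right[OF 3] diff_add_cancel)
    qed
    then show ?case by blast
  qed
  from this[of M] obtain p where
    p: "\<forall>(a, b) \<in> D. M \<le> a + b + M \<longrightarrow> block_det lam p (a, b) = \<theta> (a, b)" ..
  have "block_det lam p c = \<theta> c" if "c \<in> D" for c
    using bspec[OF p that] by (cases c) simp
  then show ?thesis unfolding solves_system_block_det D_def by blast
qed

lemma solves_system_unique:
  fixes \<theta> :: "nat \<times> nat \<Rightarrow> 'a :: field"
  assumes lam: "is_partition lam" and nz: "\<forall>c \<in> diagram (extended lam). \<theta> c \<noteq> 0"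
    and p: "solves_system lam \<theta> p" and q: "solves_system lam \<theta> q"
    and "c \<in> diagram (extended lam)"
  shows "p c = q c"
proof -
  define D where "D = diagram (extended lam)"
  have "D \<subseteq> Sigma {..length (extended lam)} (\<lambda>i. {..extended lam ! (i - 1)})"
    by (auto simp: D_def diagram_def)
  then have "finite D" by (rule finite_subset) auto
  then have "finite ((\<lambda>(a, b). a + b) ` D)" by blast
  then obtain M where M: "a + b < M" if "(a, b) \<in> D" for a b
    unfolding finite_nat_set_iff_bounded by fastforce
  have bp: "block_det lam p d = \<theta> d" and bq: "block_det lam q d = \<theta> d" if "d \<in> D" for d
    using p q that by (auto simp: solves_system_block_det D_def)
  have "p (a, b) = q (a, b)" if "(a, b) \<in> D" for a b
    using that
  proof (induction "M - (a + b)" arbitrary: a b rule: less_induct)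
    case less
    let ?n = "square_size lam (a, b)"
    have abD: "(a, b) \<in> diagram (extended lam)" using less.prems by (simp add: D_def)
    have eq: "p d = q d" if d: "d \<in> square (a, b) ?n" "d \<noteq> (a, b)" for d
    proof -
      obtain i j where [simp]: "d = (i, j)" by fastforce
      have "(i, j) \<in> D" using square_size_props(2)[OF lam abD] d by (auto simp: D_def)
      moreover have "M - (i + j) < M - (a + b)"
        using d M[OF less.prems] by (auto simp: square_def)
      ultimately show ?thesis using less.hyps by simp
    qed
    have 1: "block_det lam (p((a, b) := 0)) (a, b) = block_det lam (q((a, b) := 0)) (a, b)"
      by (rule block_det_cong) (use eq in auto)
    define u where "u = (if ?n = 1 then 1 else \<theta> (Suc a, Suc b))"
    have next_in: "(Suc a, Suc b) \<in> D" if "?n \<noteq> 1"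
      using square_size_diagonal(1)[OF lam abD] square_size_props(1)[OF lam abD] that
      by (simp add: D_def)
    have "u \<noteq> 0" using next_in nz unfolding u_def D_def by (cases "?n = 1") simp_all
    have up: "(if ?n = 1 then 1 else block_det lam p (Suc a, Suc b)) = u"
      using bp[OF next_in] unfolding u_def by (cases "?n = 1") simp_all
    have uq: "(if ?n = 1 then 1 else block_det lam q (Suc a, Suc b)) = u"
      using bq[OF next_in] unfolding u_def by (cases "?n = 1") simp_all
    have "p (a, b) * u = q (a, b) * u"
      using block_det_corner[OF lam abD, of p, unfolded up bp[OF less.prems] 1]
        block_det_corner[OF lam abD, of q, unfolded uq bq[OF less.prems]] by auto
    with \<open>u \<noteq> 0\<close> show ?case by simp
  qed
  with assms(5) show ?thesis by (cases c) (auto simp: D_def)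
qed

text \<open>A Laurent polynomial with integer coefficients in variables indexed by \<open>'v\<close> is an
  element of the group ring over \<open>\<int>\<close> of finitely supported integer exponent vectors.\<close>

type_synonym 'v laurent = "('v \<Rightarrow>\<^sub>0 int) \<Rightarrow>\<^sub>0 int"

definition laurent_eval :: "'v laurent \<Rightarrow> ('v \<Rightarrow> 'a :: field) \<Rightarrow> 'a" where
  "laurent_eval L \<theta> =
     (\<Sum>m\<in>Poly_Mapping.keys L. of_int (Poly_Mapping.lookup L m) *
        (\<Prod>v\<in>Poly_Mapping.keys m. \<theta> v powi Poly_Mapping.lookup m v))"

definition nonneg_laurent_function :: "'v set \<Rightarrow> (('v \<Rightarrow> 'a :: field_char_0) \<Rightarrow> 'a) \<Rightarrow> bool" where
  "nonneg_laurent_function V f \<longleftrightarrow>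
     (\<exists>L :: 'v laurent.
        (\<forall>m\<in>Poly_Mapping.keys L. Poly_Mapping.keys m \<subseteq> V) \<and>
        (\<forall>m. 0 \<le> Poly_Mapping.lookup L m) \<and>
        (\<forall>\<theta>. (\<forall>v\<in>V. \<theta> v \<noteq> 0) \<longrightarrow> f \<theta> = laurent_eval L \<theta>))"

end

theory Submission imports Defs begin

text \<open>Put \<open>g (i, j) = \<theta> (i, j) / \<theta> (i + 1, j + 1)\<close>, with denominator 1 outside the extended
  diagram. Then \<open>p (i, j)\<close> is the weighted sum over the lattice paths with steps down and left
  inside the extended diagram, from the last box of row \<open>i\<close> to the last box of column \<open>j\<close>, where a
  path starts with the weight \<open>g\<close> of its first box, a step left into \<open>(m, n)\<close> has weight
  \<open>g (m, n) / g (m, n + 1)\<close>, and a step down has weight 1. All these weights are Laurent monomials.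
  To see that the path sums solve the system, cut every path where it meets the
  main diagonal of a maximal square. This writes the matrix of the square as an upper triangular
  matrix with diagonal entries \<open>g\<close> times a lower unitriangular matrix, and the product of the \<open>g\<close>
  along the diagonal telescopes to \<open>\<theta>\<close> at the corner of the square.\<close>

section \<open>Laurent polynomials with non-negative coefficients\<close>

definition laurent_monomial :: "('v \<Rightarrow>\<^sub>0 int) \<Rightarrow> ('v \<Rightarrow> 'a :: field) \<Rightarrow> 'a" where
  "laurent_monomial m \<theta> = (\<Prod>v\<in>Poly_Mapping.keys m. \<theta> v powi Poly_Mapping.lookup m v)"

text \<open>Exponents off the support are 0 and \<open>x powi 0 = 1\<close>, so monomials with
  different supports can be compared over one index set.\<close>

lemma laurent_monomial_superset:
  assumes "finite S" "Poly_Mapping.keys m \<subseteq> S"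
  shows "laurent_monomial m \<theta> = (\<Prod>v\<in>S. \<theta> v powi Poly_Mapping.lookup m v)"
  unfolding laurent_monomial_def using assms
  by (intro prod.mono_neutral_left) (auto simp: in_keys_iff)

text \<open>Non-vanishing matters: exponents 1 and -1 cancel on the left, while at a zero of
  \<open>\<theta>\<close> both factors on the right vanish.\<close>

lemma laurent_monomial_add:
  assumes "\<And>v. v \<in> Poly_Mapping.keys m \<union> Poly_Mapping.keys k \<Longrightarrow> \<theta> v \<noteq> 0"
  shows "laurent_monomial (m + k) \<theta> = laurent_monomial m \<theta> * laurent_monomial k \<theta>"
proof -
  let ?S = "Poly_Mapping.keys m \<union> Poly_Mapping.keys k"
  have "laurent_monomial (m + k) \<theta> = (\<Prod>v\<in>?S. \<theta> v powi Poly_Mapping.lookup (m + k) v)"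
    by (rule laurent_monomial_superset) (auto dest: Poly_Mapping.keys_add[THEN subsetD])
  also have "\<dots> = (\<Prod>v\<in>?S. \<theta> v powi Poly_Mapping.lookup m v * \<theta> v powi Poly_Mapping.lookup k v)"
    using assms by (intro prod.cong) (auto simp: lookup_add power_int_add)
  also have "\<dots> = laurent_monomial m \<theta> * laurent_monomial k \<theta>"
    by (simp add: prod.distrib laurent_monomial_superset[of ?S])
  finally show ?thesis .
qed

lemma laurent_eval_superset:
  assumes "finite S" "Poly_Mapping.keys L \<subseteq> S"
  shows "laurent_eval L \<theta> = (\<Sum>m\<in>S. of_int (Poly_Mapping.lookup L m) * laurent_monomial m \<theta>)"
  unfolding laurent_eval_def laurent_monomial_def[symmetric] using assms
  by (intro sum.mono_neutral_left) (auto simp: in_keys_iff)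

lemma laurent_eval_zero: "laurent_eval 0 \<theta> = 0"
  by (simp add: laurent_eval_def)

lemma laurent_eval_add: "laurent_eval (L + M) \<theta> = laurent_eval L \<theta> + laurent_eval M \<theta>"
proof -
  let ?S = "Poly_Mapping.keys L \<union> Poly_Mapping.keys M"
  have "laurent_eval (L + M) \<theta> =
      (\<Sum>m\<in>?S. of_int (Poly_Mapping.lookup (L + M) m) * laurent_monomial m \<theta>)"
    by (rule laurent_eval_superset) (auto dest: Poly_Mapping.keys_add[THEN subsetD])
  then show ?thesis
    by (simp add: lookup_add distrib_right sum.distrib laurent_eval_superset[of ?S])
qed

lemma laurent_eval_sum: "laurent_eval (\<Sum>i\<in>I. L i) \<theta> = (\<Sum>i\<in>I. laurent_eval (L i) \<theta>)"
  by (induction I rule: infinite_finite_induct) (simp_all add: laurent_eval_zero laurent_eval_add)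

lemma laurent_eval_single:
  "laurent_eval (Poly_Mapping.single m c) \<theta> = of_int c * laurent_monomial m \<theta>"
  by (subst laurent_eval_superset[of "{m}"]) auto

section \<open>Closure properties of non-negative Laurent functions\<close>

lemma nonneg_laurent_monomial:
  assumes "Poly_Mapping.keys m \<subseteq> V"
  shows "nonneg_laurent_function V (laurent_monomial m)"
  unfolding nonneg_laurent_function_def using assms
  by (intro exI[of _ "Poly_Mapping.single m 1"])
     (simp add: laurent_eval_single lookup_single when_def)

lemma nonneg_laurent_cong:
  assumes "nonneg_laurent_function V f"
    and "\<And>\<theta>. (\<forall>v\<in>V. \<theta> v \<noteq> 0) \<Longrightarrow> h \<theta> = f \<theta>"
  shows "nonneg_laurent_function V h"
  using assms unfolding nonneg_laurent_function_def by metis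

lemma nonneg_laurent_one: "nonneg_laurent_function V (\<lambda>\<theta>. 1)"
  by (rule nonneg_laurent_cong[OF nonneg_laurent_monomial[of 0]])
     (simp_all add: laurent_monomial_def)

lemma nonneg_laurent_powi:
  assumes "v \<in> V"
  shows "nonneg_laurent_function V (\<lambda>\<theta>. \<theta> v powi e)"
  by (rule nonneg_laurent_cong[OF nonneg_laurent_monomial[of "Poly_Mapping.single v e"]])
     (use assms in \<open>auto simp: laurent_monomial_superset[of "{v}"]\<close>)

lemma nonneg_laurent_zero: "nonneg_laurent_function V (\<lambda>\<theta>. 0)"
  unfolding nonneg_laurent_function_def by (intro exI[of _ 0]) (simp add: laurent_eval_zero)

lemma nonneg_laurent_add:
  assumes "nonneg_laurent_function V f" "nonneg_laurent_function V h"
  shows "nonneg_laurent_function V (\<lambda>\<theta>. f \<theta> + h \<theta>)"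
proof -
  obtain L where L: "\<forall>m\<in>Poly_Mapping.keys L. Poly_Mapping.keys m \<subseteq> V"
      "\<forall>m. 0 \<le> Poly_Mapping.lookup L m"
      "\<forall>\<theta>. (\<forall>v\<in>V. \<theta> v \<noteq> 0) \<longrightarrow> f \<theta> = laurent_eval L \<theta>"
    using assms(1) unfolding nonneg_laurent_function_def by blast
  obtain M where M: "\<forall>m\<in>Poly_Mapping.keys M. Poly_Mapping.keys m \<subseteq> V"
      "\<forall>m. 0 \<le> Poly_Mapping.lookup M m"
      "\<forall>\<theta>. (\<forall>v\<in>V. \<theta> v \<noteq> 0) \<longrightarrow> h \<theta> = laurent_eval M \<theta>"
    using assms(2) unfolding nonneg_laurent_function_def by blast
  have "\<forall>m\<in>Poly_Mapping.keys (L + M). Poly_Mapping.keys m \<subseteq> V"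
    using L(1) M(1) Poly_Mapping.keys_add[of L M] by blast
  then show ?thesis
    unfolding nonneg_laurent_function_def using L(2,3) M(2,3)
    by (intro exI[of _ "L + M"]) (simp add: lookup_add laurent_eval_add)
qed

lemma nonneg_laurent_sum:
  assumes "\<And>i. i \<in> I \<Longrightarrow> nonneg_laurent_function V (f i)"
  shows "nonneg_laurent_function V (\<lambda>\<theta>. \<Sum>i\<in>I. f i \<theta>)"
  using assms
  by (induction I rule: infinite_finite_induct) (simp_all add: nonneg_laurent_zero nonneg_laurent_add)

lemma nonneg_laurent_mult:
  assumes "nonneg_laurent_function V f" "nonneg_laurent_function V h"
  shows "nonneg_laurent_function V (\<lambda>\<theta>. f \<theta> * h \<theta>)"
proof -
  obtain L where L: "\<forall>m\<in>Poly_Mapping.keys L. Poly_Mapping.keys m \<subseteq> V"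
      "\<forall>m. 0 \<le> Poly_Mapping.lookup L m"
      "\<forall>\<theta>. (\<forall>v\<in>V. \<theta> v \<noteq> 0) \<longrightarrow> f \<theta> = laurent_eval L \<theta>"
    using assms(1) unfolding nonneg_laurent_function_def by blast
  obtain M where M: "\<forall>m\<in>Poly_Mapping.keys M. Poly_Mapping.keys m \<subseteq> V"
      "\<forall>m. 0 \<le> Poly_Mapping.lookup M m"
      "\<forall>\<theta>. (\<forall>v\<in>V. \<theta> v \<noteq> 0) \<longrightarrow> h \<theta> = laurent_eval M \<theta>"
    using assms(2) unfolding nonneg_laurent_function_def by blast
  \<comment> \<open>\<open>Q\<close> is the product of \<open>L\<close> and \<open>M\<close> in the
    group ring, spread out over pairs of monomials so that support and signs can be checked term by
    term.\<close>
  define T where "T = (\<lambda>m k. Poly_Mapping.single (m + k)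
    (Poly_Mapping.lookup L m * Poly_Mapping.lookup M k))"
  define Q where "Q = (\<Sum>m\<in>Poly_Mapping.keys L. \<Sum>k\<in>Poly_Mapping.keys M. T m k)"
  have "Poly_Mapping.keys x \<subseteq> V" if x: "x \<in> Poly_Mapping.keys Q" for x
  proof -
    from x obtain m where m: "m \<in> Poly_Mapping.keys L"
        "x \<in> Poly_Mapping.keys (\<Sum>k\<in>Poly_Mapping.keys M. T m k)"
      unfolding Q_def by (blast dest: Poly_Mapping.keys_sum[THEN subsetD])
    then obtain k where k: "k \<in> Poly_Mapping.keys M" "x \<in> Poly_Mapping.keys (T m k)"
      by (blast dest: Poly_Mapping.keys_sum[THEN subsetD])
    then have "x = m + k" by (auto simp: T_def split: if_splits)
    with L(1) M(1) m(1) k(1) show ?thesis using Poly_Mapping.keys_add[of m k] by blast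
  qed
  moreover have "0 \<le> Poly_Mapping.lookup Q x" for x
    unfolding Q_def T_def using L(2) M(2)
    by (auto simp: lookup_sum lookup_single when_def intro!: sum_nonneg)
  moreover have "f \<theta> * h \<theta> = laurent_eval Q \<theta>" if \<theta>: "\<forall>v\<in>V. \<theta> v \<noteq> 0" for \<theta>
  proof -
    have "laurent_eval (T m k) \<theta> =
        (of_int (Poly_Mapping.lookup L m) * laurent_monomial m \<theta>) *
        (of_int (Poly_Mapping.lookup M k) * laurent_monomial k \<theta>)"
      if "m \<in> Poly_Mapping.keys L" "k \<in> Poly_Mapping.keys M" for m k
    proof -
      have "laurent_monomial (m + k) \<theta> = laurent_monomial m \<theta> * laurent_monomial k \<theta>"
        using that L(1) M(1) \<theta> by (intro laurent_monomial_add) blast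
      then show ?thesis by (simp add: T_def laurent_eval_single)
    qed
    then have "laurent_eval Q \<theta> = laurent_eval L \<theta> * laurent_eval M \<theta>"
      unfolding Q_def laurent_eval_sum
      by (simp add: laurent_eval_superset[of "Poly_Mapping.keys L" L]
          laurent_eval_superset[of "Poly_Mapping.keys M" M] sum_product)
    with L(3) M(3) \<theta> show ?thesis by simp
  qed
  ultimately show ?thesis unfolding nonneg_laurent_function_def by (intro exI[of _ Q]) blast
qed

section \<open>Path sums\<close>

definition diag_ratio :: "(nat \<times> nat) set \<Rightarrow> (nat \<times> nat \<Rightarrow> 'a :: field) \<Rightarrow> nat \<times> nat \<Rightarrow> 'a" where
  "diag_ratio D \<theta> = (\<lambda>(m, n). \<theta> (m, n) / (if (Suc m, Suc n) \<in> D then \<theta> (Suc m, Suc n) else 1))"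

text \<open>\<open>path_sum D g j n m\<close> sums the weights of the paths from box \<open>(m, n)\<close> to the last box of
  column \<open>j\<close>; the summation index is the row in which a path leaves column \<open>n\<close>.\<close>

primrec path_sum ::
  "(nat \<times> nat) set \<Rightarrow> (nat \<times> nat \<Rightarrow> 'a :: field) \<Rightarrow> nat \<Rightarrow> nat \<Rightarrow> nat \<Rightarrow> 'a" where
  "path_sum D g j 0 m = 0"
| "path_sum D g j (Suc n) m =
    (if Suc n < j then 0 else if Suc n = j then 1 else
      \<Sum>m' | m \<le> m' \<and> (m', Suc n) \<in> D. g (m', n) / g (m', Suc n) * path_sum D g j n m')"

lemma path_sum_less: "n < j \<Longrightarrow> path_sum D g j n m = 0"
  by (cases n) auto

lemma path_sum_same: "0 < n \<Longrightarrow> path_sum D g n n m = 1"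
  by (cases n) auto

lemma path_sum_not_in:
  assumes "j < n" "\<And>m'. m \<le> m' \<Longrightarrow> (m', n) \<notin> D"
  shows "path_sum D g j n m = 0"
proof (cases n)
  case (Suc k)
  then have "{m'. m \<le> m' \<and> (m', Suc k) \<in> D} = {}" using assms(2) by auto
  with Suc assms(1) show ?thesis by (simp only: path_sum.simps sum.empty) simp
qed simp

text \<open>A path either turns left in row \<open>m\<close> at once or goes down first; the exit
  rows split accordingly. Finiteness matters because a sum over an infinite set is 0 by
  default.\<close>

lemma path_sum_step:
  assumes "finite D" "(m, Suc n) \<in> D" "j \<le> n"
  shows "path_sum D g j (Suc n) m =
    path_sum D g j (Suc n) (Suc m) + g (m, n) / g (m, Suc n) * path_sum D g j n m"
proof -
  let ?A = "\<lambda>m. {m'. m \<le> m' \<and> (m', Suc n) \<in> D}"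
  have "?A (Suc m) \<subseteq> fst ` D" by force
  then have "finite (?A (Suc m))" using assms(1) by (simp add: finite_subset)
  moreover have "?A m = insert m (?A (Suc m))"
    using assms(2) Suc_leD by (auto simp: le_less Suc_le_eq)
  ultimately show ?thesis using assms(3) by (simp add: add.commute)
qed

declare path_sum.simps(2) [simp del]

definition row_path_sum ::
  "nat list \<Rightarrow> (nat \<times> nat \<Rightarrow> 'a :: field) \<Rightarrow> nat \<times> nat \<Rightarrow> 'a" where
  "row_path_sum lam \<theta> = (\<lambda>(i, j).
     let D = diagram (extended lam); g = diag_ratio D \<theta>; e = extended lam ! (i - 1)
     in g (i, e) * path_sum D g j e i)"

lemma finite_diagram: "finite (diagram lam)"
proof (rule finite_subset)
  show "diagram lam \<subseteq> Sigma {..length lam} (\<lambda>i. {..lam ! (i - 1)})" by (auto simp: diagram_def)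
qed auto

text \<open>Every weight is a product of values of \<open>\<theta>\<close> and their inverses at
  boxes of \<open>D\<close>, and path sums combine weights by addition and multiplication
  only.\<close>

lemma nonneg_laurent_row_path_sum:
  fixes lam :: "nat list"
  defines "D \<equiv> diagram (extended lam)"
  assumes lam: "is_partition lam" and ij: "(i, j) \<in> D"
  shows "nonneg_laurent_function D
    (\<lambda>\<theta> :: nat \<times> nat \<Rightarrow> 'a :: field_char_0. row_path_sum lam \<theta> (i, j))"
proof -
  note closed = diagram_extended_down_closed[OF lam, folded D_def]
  let ?nn = "\<lambda>f :: (nat \<times> nat \<Rightarrow> 'a) \<Rightarrow> 'a. nonneg_laurent_function D f"
  have var: "?nn (\<lambda>\<theta>. \<theta> c)" if "c \<in> D" for c
    using nonneg_laurent_powi[OF that, of 1] by simp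
  have inv: "?nn (\<lambda>\<theta>. inverse (\<theta> c))" if "c \<in> D" for c
    using nonneg_laurent_powi[OF that, of "-1"] by (simp add: power_int_minus)
  have g: "?nn (\<lambda>\<theta>. diag_ratio D \<theta> (m, n))" if "(m, n) \<in> D" for m n
    using nonneg_laurent_mult[OF var[OF that] inv[of "(Suc m, Suc n)"]] var[OF that]
    by (cases "(Suc m, Suc n) \<in> D") (simp_all add: diag_ratio_def divide_inverse)
  have ginv: "?nn (\<lambda>\<theta>. inverse (diag_ratio D \<theta> (m, n)))" if "(m, n) \<in> D" for m n
    using nonneg_laurent_mult[OF inv[OF that] var[of "(Suc m, Suc n)"]] inv[OF that]
    by (cases "(Suc m, Suc n) \<in> D") (simp_all add: diag_ratio_def divide_inverse)
  have j: "1 \<le> j" using ij by (simp add: D_def diagram_def)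
  have ps: "?nn (\<lambda>\<theta>. path_sum D (diag_ratio D \<theta>) j n m)" for n m
  proof (induction n arbitrary: m)
    case (Suc n)
    consider "Suc n < j" | "Suc n = j" | "j < Suc n" by linarith
    then show ?case
    proof cases
      case 3
      have "?nn (\<lambda>\<theta>. diag_ratio D \<theta> (m', n) * (inverse (diag_ratio D \<theta> (m', Suc n))
          * path_sum D (diag_ratio D \<theta>) j n m'))" if m': "(m', Suc n) \<in> D" for m'
      proof -
        \<comment> \<open>Columns start at 1: \<open>j \<le> n\<close> gives
          \<open>1 \<le> n\<close>, so the left neighbour is a genuine box.\<close>
        have "1 \<le> m'" using m' by (simp add: D_def diagram_def)
        with closed[OF m', of m' n] j 3 have "(m', n) \<in> D" by simp
        then show ?thesis by (intro nonneg_laurent_mult g ginv m' Suc.IH)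
      qed
      with 3 show ?thesis
        by (auto simp: path_sum.simps(2) divide_inverse mult.assoc intro!: nonneg_laurent_sum)
    qed (auto simp: path_sum.simps(2) nonneg_laurent_zero nonneg_laurent_one)
  qed (simp add: nonneg_laurent_zero)
  have "(i, extended lam ! (i - 1)) \<in> D" using ij by (simp add: D_def diagram_def)
  then show ?thesis
    unfolding row_path_sum_def D_def[symmetric] prod.case Let_def
    by (intro nonneg_laurent_mult g ps)
qed

section \<open>Determinants of path sums\<close>

text \<open>Here \<open>u k\<close> is the sum over the paths from \<open>(a + s, b + s + d)\<close> to \<open>(a + k, b + k)\<close>. The value
  of \<open>u s\<close> comes from the straight path along row \<open>a + s\<close>, whose weight telescopes.\<close>

lemma path_sum_cut_diagonal:
  fixes g :: "nat \<times> nat \<Rightarrow> 'a :: field"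
  assumes fin: "finite D"
    and closed: "\<And>i j i' j'. (i, j) \<in> D \<Longrightarrow> 1 \<le> i' \<Longrightarrow> i' \<le> i \<Longrightarrow> 1 \<le> j' \<Longrightarrow> j' \<le> j \<Longrightarrow> (i', j') \<in> D"
    and g: "\<And>c. c \<in> D \<Longrightarrow> g c \<noteq> 0"
    and ab: "1 \<le> a" "1 \<le> b"
    and sq: "square (a, b) N \<subseteq> D" and max: "(a + N, b + N) \<notin> D"
    and s: "s < N" "(a + s, b + s + d) \<in> D"
  shows "\<exists>u. (\<forall>k<s. u k = 0) \<and> u s = g (a + s, b + s) / g (a + s, b + s + d) \<and>
    (\<forall>t<N. path_sum D g (b + t) (b + s + d) (a + s) =
      (\<Sum>k<N. u k * path_sum D g (b + t) (b + k) (a + k)))"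
  using s
\<comment> \<open>\<open>d\<close> is the distance to the diagonal. A step left lowers it with
  \<open>s\<close> fixed, a step down lowers it while raising \<open>s\<close>.\<close>
proof (induction d arbitrary: s)
  case 0
  let ?u = "\<lambda>k. if k = s then 1 else 0 :: 'a"
  have "(\<Sum>k<N. ?u k * f k) = f s" for f :: "nat \<Rightarrow> 'a"
    using 0 by (subst sum.remove[of _ s]) auto
  then show ?case using 0 g by (intro exI[of _ ?u]) auto
next
  case (Suc d)
  let ?P = "path_sum D g"
  let ?w = "g (a + s, b + s + d) / g (a + s, b + s + Suc d)"
  have left: "(a + s, b + s + d) \<in> D"
    by (rule closed[OF Suc.prems(2)]) (use ab in auto)
  obtain u where u: "\<forall>k<s. u k = 0" "u s = g (a + s, b + s) / g (a + s, b + s + d)"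
      "\<And>t. t < N \<Longrightarrow> ?P (b + t) (b + s + d) (a + s) = (\<Sum>k<N. u k * ?P (b + t) (b + k) (a + k))"
    using Suc.IH[OF Suc.prems(1) left] by blast
  \<comment> \<open>\<open>v\<close> collects the paths that go down first; these meet the diagonal
    only below row \<open>a + s\<close>.\<close>
  have "\<exists>v. (\<forall>k\<le>s. v k = 0) \<and> (\<forall>t<N. ?P (b + t) (b + s + Suc d) (Suc (a + s)) =
      (\<Sum>k<N. v k * ?P (b + t) (b + k) (a + k)))"
  proof (cases "(Suc (a + s), b + s + Suc d) \<in> D")
    case True
    \<comment> \<open>Otherwise the box below would force the corner \<open>(a + N, b + N)\<close>
      into \<open>D\<close>.\<close>
    have "Suc s < N"
    proof (rule ccontr)
      assume "\<not> Suc s < N"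
      with Suc.prems(1) have "N = Suc s" by simp
      then have "(a + N, b + N) \<in> D" using closed[OF True, of "a + N" "b + N"] by simp
      with max show False ..
    qed
    moreover have "(a + Suc s, b + Suc s + d) \<in> D" using True by simp
    ultimately obtain v where "\<forall>k<Suc s. v k = 0" 
        "\<And>t. t < N \<Longrightarrow> ?P (b + t) (b + Suc s + d) (a + Suc s) = (\<Sum>k<N. v k * ?P (b + t) (b + k) (a + k))"
      using Suc.IH by blast
    then show ?thesis by (intro exI[of _ v]) (simp add: less_Suc_eq_le)
  next
    case False
    have no: "(m, b + s + Suc d) \<notin> D" if "Suc (a + s) \<le> m" for m
      using closed[of m "b + s + Suc d" "Suc (a + s)" "b + s + Suc d"] that False by auto
    \<comment> \<open>With no box below, the column lies to the right of the square, so all target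
      columns are strictly to its left and no path starts downwards.\<close>
    have "b + N \<le> b + s + Suc d"
    proof (rule ccontr)
      assume "\<not> b + N \<le> b + s + Suc d"
      then have "(Suc (a + s), b + s + Suc d) \<in> square (a, b) N" by (auto simp: square_def)
      with sq False show False by blast
    qed
    then have "?P (b + t) (b + s + Suc d) (Suc (a + s)) = 0" if "t < N" for t
      using that no by (intro path_sum_not_in) auto
    then show ?thesis by (intro exI[of _ "\<lambda>_. 0"]) simp
  qed
  then obtain v where v: "\<forall>k\<le>s. v k = 0"
      "\<And>t. t < N \<Longrightarrow> ?P (b + t) (b + s + Suc d) (Suc (a + s)) =
        (\<Sum>k<N. v k * ?P (b + t) (b + k) (a + k))" by blast
  \<comment> \<open>Extends \<open>path_sum_step\<close> to target columns not to the left: in the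
    starting column both vertical sums are 1 and the left term is 0; further right everything is
    0.\<close>
  have step: "?P (b + t) (b + s + Suc d) (a + s) =
      ?P (b + t) (b + s + Suc d) (Suc (a + s)) + ?w * ?P (b + t) (b + s + d) (a + s)" for t
  proof -
    consider "b + t \<le> b + s + d" | "b + t = b + s + Suc d" | "b + s + Suc d < b + t" by linarith
    then show ?thesis
    proof cases
      case 1
      then show ?thesis using path_sum_step[OF fin, of "a + s" "b + s + d" "b + t" g] Suc.prems(2)
        by simp
    next
      case 2
      then show ?thesis
        using path_sum_same[of "b + t" D g] ab by (simp only: path_sum_less) simp
    qed (simp add: path_sum_less)
  qed
  show ?case
  \<comment> \<open>The first step is down, counted by \<open>v\<close>, or left with weight
    \<open>?w\<close>, counted by \<open>u\<close>.\<close>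
  proof (intro exI[of _ "\<lambda>k. v k + ?w * u k"] conjI allI impI)
    fix k assume "k < s"
    then show "v k + ?w * u k = 0" using u v by simp
  next
    show "v s + ?w * u s = g (a + s, b + s) / g (a + s, b + s + Suc d)"
      using u(2) v(1) g[OF left] by simp
  next
    fix t assume t: "t < N"
    then show "?P (b + t) (b + s + Suc d) (a + s) =
        (\<Sum>k<N. (v k + ?w * u k) * ?P (b + t) (b + k) (a + k))"
      unfolding step v(2)[OF t] u(3)[OF t] by (simp add: distrib_right sum.distrib sum_distrib_left mult.assoc)
  qed
qed

text \<open>The product telescopes. Since the diagonal leaves \<open>D\<close> after
  \<open>n\<close> boxes, the last denominator is the default 1, which \<open>?t\<close> records at
  \<open>k = n\<close>.\<close>

lemma prod_diag_ratio:
  assumes "square (a, b) n \<subseteq> D" "(a + n, b + n) \<notin> D" "\<And>c. c \<in> D \<Longrightarrow> \<theta> c \<noteq> 0" "0 < n"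
  shows "(\<Prod>k<n. diag_ratio D \<theta> (a + k, b + k)) = \<theta> (a, b)"
proof -
  let ?t = "\<lambda>k. if k = n then 1 else \<theta> (a + k, b + k)"
  have D: "(a + k, b + k) \<in> D" if "k < n" for k
    using assms(1) that by (auto simp: square_def)
  have "diag_ratio D \<theta> (a + k, b + k) = ?t k / ?t (Suc k)" if "k < n" for k
    using that D[of "Suc k"] assms(2) by (cases "Suc k = n") (auto simp: diag_ratio_def)
  then have "(\<Prod>k<n. diag_ratio D \<theta> (a + k, b + k)) = (\<Prod>k<n. ?t k / ?t (Suc k))"
    by (intro prod.cong) auto
  also have "\<dots> = ?t 0 / ?t n"
    using D assms(3) by (intro prod_lessThan_telescope') auto
  finally show ?thesis using assms(4) by simp
qed

lemma solves_system_row_path_sum: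
  fixes \<theta> :: "nat \<times> nat \<Rightarrow> 'a :: field"
  assumes lam: "is_partition lam" and nz: "\<forall>c \<in> diagram (extended lam). \<theta> c \<noteq> 0"
  shows "solves_system lam \<theta> (row_path_sum lam \<theta>)"
  unfolding solves_system_def
proof safe
  fix a b assume abD: "(a, b) \<in> diagram (extended lam)"
  define D where "D = diagram (extended lam)"
  define g where "g = diag_ratio D \<theta>"
  define N where "N = square_size lam (a, b)"
  define e where "e i = extended lam ! (i - 1)" for i
  let ?P = "path_sum D g"
  have ab: "1 \<le> a" "1 \<le> b" using abD by (auto simp: diagram_def)
  note props = square_size_props[OF lam abD, folded D_def N_def]
  \<comment> \<open>Otherwise a square of size \<open>Suc N\<close> would fit.\<close>
  have max: "(a + N, b + N) \<notin> D"
    using props(3)[of "Suc N"] square_subset_iff[OF lam ab, of "Suc N"] by (auto simp: D_def)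
  have gnz: "g c \<noteq> 0" if "c \<in> D" for c
    using that nz by (cases c) (auto simp: g_def diag_ratio_def D_def)
  have last: "b + s \<le> e (a + s)" "(a + s, e (a + s)) \<in> D" if "s < N" for s
  proof -
    have "(a + s, b + s) \<in> D" using props(2) that by (auto simp: square_def)
    then show "b + s \<le> e (a + s)" "(a + s, e (a + s)) \<in> D"
      by (auto simp: D_def diagram_def e_def)
  qed
  define R where "R s u \<longleftrightarrow>
    (\<forall>k<s. u k = 0) \<and> u s = g (a + s, b + s) / g (a + s, e (a + s)) \<and>
    (\<forall>t<N. ?P (b + t) (e (a + s)) (a + s) = (\<Sum>k<N. u k * ?P (b + t) (b + k) (a + k)))" for s u
  have "\<forall>s\<in>{..<N}. \<exists>u. R s u"
  proof
    fix s assume "s \<in> {..<N}"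
    then have s: "s < N" by simp
    \<comment> \<open>The distance \<open>d\<close> is chosen so that the path starts at the last
      box of row \<open>a + s\<close>.\<close>
    have eq: "b + s + (e (a + s) - (b + s)) = e (a + s)" using last(1)[OF s] by simp
    show "\<exists>u. R s u"
      unfolding R_def
      by (rule path_sum_cut_diagonal[of D g a b N s "e (a + s) - (b + s)", unfolded eq,
            OF _ diagram_extended_down_closed[OF lam, folded D_def] gnz ab props(2) max s last(2)[OF s]])
         (simp_all add: D_def finite_diagram)
  qed
  from bchoice[OF this] obtain u where R: "\<And>s. s < N \<Longrightarrow> R s (u s)" by blast
  have u: "u s k = 0" if "s < N" "k < s" for s k
    using R[OF that(1)] that(2) by (simp add: R_def)
  have u_diag: "u s s = g (a + s, b + s) / g (a + s, e (a + s))" if "s < N" for s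
    using R[OF that] by (simp add: R_def)
  have u_sum: "?P (b + t) (e (a + s)) (a + s) = (\<Sum>k<N. u s k * ?P (b + t) (b + k) (a + k))"
    if "s < N" "t < N" for s t
    using R[OF that(1)] that(2) by (simp add: R_def)
  \<comment> \<open>The initial weight of the paths cancels the denominator of \<open>u s s\<close>,
    leaving \<open>g (a + s, b + s)\<close> on the diagonal.\<close>
  define U where "U = mat N N (\<lambda>(s, k). g (a + s, e (a + s)) * u s k)"
  define L where "L = mat N N (\<lambda>(k, t). ?P (b + t) (b + k) (a + k))"
  have UL: "U \<in> carrier_mat N N" "L \<in> carrier_mat N N" by (auto simp: U_def L_def)
  have rps: "row_path_sum lam \<theta> (i, j) = g (i, e i) * ?P j (e i) i" for i j
    by (simp add: row_path_sum_def Let_def D_def g_def e_def)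
  have "mat N N (\<lambda>(i, j). row_path_sum lam \<theta> (a + i, b + j)) = U * L"
    by (rule eq_matI)
       (auto simp: U_def L_def scalar_prod_def rps u_sum sum_distrib_left mult.assoc atLeast0LessThan)
  moreover have "det U = (\<Prod>k<N. g (a + k, b + k))"
  proof -
    have "upper_triangular U" by (auto simp: U_def u)
    then have "det U = prod_list (diag_mat U)" using UL(1) by (rule det_upper_triangular)
    also have "\<dots> = (\<Prod>k<N. U $$ (k, k))"
      using UL(1) by (simp add: prod_list_diag_prod atLeast0LessThan)
    also have "\<dots> = (\<Prod>k<N. g (a + k, b + k))"
      by (rule prod.cong) (auto simp: U_def u_diag gnz[OF last(2)])
    finally show ?thesis .
  qed
  moreover have "det L = 1"
  proof -
    \<comment> \<open>Paths never move right, so from diagonal box \<open>k\<close> no column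
      \<open>b + t\<close> with \<open>t > k\<close> is reached.\<close>
    have "det L = prod_list (diag_mat L)"
      using UL(2) by (intro det_lower_triangular[of N]) (auto simp: L_def path_sum_less)
    also have "\<dots> = (\<Prod>k<N. L $$ (k, k))"
      using UL(2) by (simp add: prod_list_diag_prod atLeast0LessThan)
    also have "\<dots> = 1"
      using ab by (intro prod.neutral) (auto simp: L_def path_sum_same)
    finally show ?thesis .
  qed
  moreover have "(\<Prod>k<N. g (a + k, b + k)) = \<theta> (a, b)"
    unfolding g_def using props(1,2) max nz by (intro prod_diag_ratio) (auto simp: D_def)
  ultimately show "det (mat (square_size lam (a, b)) (square_size lam (a, b))
      (\<lambda>(i, j). row_path_sum lam \<theta> (a + i, b + j))) = \<theta> (a, b)"
    unfolding N_def[symmetric] using det_mult[OF UL] by simp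
qed

text \<open>The extended diagram contains \<open>lam\<close> shifted one step along the diagonal;
  down-closure does the rest.\<close>

lemma diagram_subset_extended:
  assumes "is_partition lam"
  shows "diagram lam \<subseteq> diagram (extended lam)"
proof safe
  fix a b assume ab: "(a, b) \<in> diagram lam"
  then have "(Suc a, Suc b) \<in> diagram (extended lam)"
    by (auto simp: diagram_def extended_def nth_Cons')
  then show "(a, b) \<in> diagram (extended lam)"
    by (rule diagram_extended_down_closed[OF assms]) (use ab in \<open>auto simp: diagram_def\<close>)
qed

theorem theorem2p2:
  fixes lam :: "nat list"
    and p :: "(nat \<times> nat \<Rightarrow> 'a :: field_char_0) \<Rightarrow> nat \<times> nat \<Rightarrow> 'a"
  assumes "is_partition lam"
    and "\<And>\<theta>. (\<forall>c \<in> diagram (extended lam). \<theta> c \<noteq> 0) \<Longrightarrow> solves_system lam \<theta> (p \<theta>)"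
  shows "\<forall>(a, b) \<in> diagram lam.
           nonneg_laurent_function (diagram (extended lam)) (\<lambda>\<theta>. p \<theta> (a, b))"
proof safe
  fix a b assume "(a, b) \<in> diagram lam"
  then have ab: "(a, b) \<in> diagram (extended lam)"
    using diagram_subset_extended[OF assms(1)] by blast
  show "nonneg_laurent_function (diagram (extended lam)) (\<lambda>\<theta>. p \<theta> (a, b))"
  \<comment> \<open>Only parameters without zeros matter here, and for these uniqueness identifies
    \<open>p \<theta>\<close> with the path sums on the extended diagram.\<close>
  proof (rule nonneg_laurent_cong[OF nonneg_laurent_row_path_sum[OF assms(1) ab]])
    fix \<theta> :: "nat \<times> nat \<Rightarrow> 'a"
    assume nz: "\<forall>c \<in> diagram (extended lam). \<theta> c \<noteq> 0"
    show "p \<theta> (a, b) = row_path_sum lam \<theta> (a, b)"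
      by (rule solves_system_unique[OF assms(1) nz assms(2)[OF nz]
            solves_system_row_path_sum[OF assms(1) nz] ab])
  qed
qed

end
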